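(* Let $G$ be a simple connected graph on $[n]$ such that its Laplacian simplex $\mathcal{P}_G$ is reflexive. Let $\mathcal{C}(\mathcal{P}_G)\subseteq\mathbb{Z}_n^n$ be its associated linear code and $\mathcal{C}(\mathcal{P}_G)^\perp$ its dual code. Order the vertices $\mathbf{v}_1,\dots,\mathbf{v}_n$ of the dual simplex $\mathcal{P}_G^\vee$ so that $\mathbf{v}_i$ satisfies $\ell_j\mathbf{v}_i^T=1$ for all $j\ne i$, where $\ell_j$ is the $j$-th row of $L(n)$. Then \[ \Lambda(\mathcal{P}_G^\vee)=\left\{\frac{\mathbf{x}}{n}\;\middle|\;\mathbf{x}\in\mathbb{Z}^n,\ 0\le x_i<n,\ (\mathbf{x}\bmod n)\in\mathcal{C}(\mathcal{P}_G)^\perp\right\}. \]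
   Context: The Laplacian matrix $L$ of a simple graph on $[n]$ has $L_{ii}=\deg(i)$, $L_{ij}=-1$ if $\{i,j\}$ is an edge and $0$ otherwise; $L(n)$ is $L$ with its $n$-th column deleted. The Laplacian simplex $\mathcal{P}_G\subset\mathbb{R}^{n-1}$ is the convex hull of the rows of $L(n)$; its dual is $\mathcal{P}_G^\vee=\{\mathbf{x}\mid L(n)\mathbf{x}^T\le\mathbb{1}\}$. A lattice polytope is reflexive if it contains the origin in its interior and its dual is a lattice polytope. The associated linear code is $\mathcal{C}(\mathcal{P}_G)=\{\bar{\mathbf{x}}\in\mathbb{Z}_n^n\mid \bar{\mathbf{x}}[L(n)\mid\mathbb{1}]=\mathbf{0} \text{ in } \mathbb{Z}_n^n\}$, where $[L(n)\mid\mathbb{1}]$ is $L(n)$ with a column of ones appended. The dual code of $\mathcal{C}\subseteq\mathbb{Z}_n^n$ is $\{\mathbf{y}\in\mathbb{Z}_n^n\mid \mathbf{y}\cdot\mathbf{c}=0\ \forall\mathbf{c}\in\mathcal{C}\}$. For a lattice simplex with ordered vertices $\mathbf{v}_1,\dots,\mathbf{v}_{d+1}$, $\Lambda(\mathcal{P})$ is the set of $\lambda\in[0,1)^{d+1}$ with $\sum_i\lambda_i(\mathbf{v}_i,1)\in\mathbb{Z}^{d+1}$. *)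

theory Defs
  imports
    "HOL-Analysis.Analysis"
    "HOL-Library.Function_Algebras"
    "HOL-Number_Theory.Cong"
    "Graph_Theory.Digraph_Component"
begin

text \<open>
  Conventions. Indices start at 0: the vertex set \<open>[n]\<close> is \<open>{0..<n}\<close>, and the \<open>n\<close>-th row or
  column is the one with index \<open>n - 1\<close>. The space \<open>\<real>\<^sup>d\<close> is
  \<open>topspace (Euclidean_space d)\<close>, that is, the functions \<open>nat \<Rightarrow> real\<close> that vanish at all
  indices \<open>\<ge> d\<close>, so that the dimension may depend on \<open>n\<close> (and \<open>d = 0\<close> is allowed). The pointwise
  vector space structure below makes the library notions of convex hull and extreme point
  available there.
\<close>

instantiation "fun" :: (type, real_vector) real_vector
begin

definition scaleR_fun :: "real \<Rightarrow> ('a \<Rightarrow> 'b) \<Rightarrow> 'a \<Rightarrow> 'b" where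
  "scaleR_fun c f = (\<lambda>x. c *\<^sub>R f x)"

instance
  by standard (auto simp: scaleR_fun_def fun_eq_iff scaleR_add_right scaleR_add_left)

end


subsection \<open>Lattice polytopes\<close>

definition dot :: "nat \<Rightarrow> (nat \<Rightarrow> real) \<Rightarrow> (nat \<Rightarrow> real) \<Rightarrow> real" where
  "dot d x y = (\<Sum>k<d. x k * y k)"

definition integer_lattice :: "nat \<Rightarrow> (nat \<Rightarrow> real) set" where
  "integer_lattice d = {x \<in> topspace (Euclidean_space d). \<forall>k. x k \<in> \<int>}"

definition lattice_polytope :: "nat \<Rightarrow> (nat \<Rightarrow> real) set \<Rightarrow> bool" where
  "lattice_polytope d P \<longleftrightarrow> (\<exists>S. finite S \<and> S \<subseteq> integer_lattice d \<and> P = convex hull S)"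

definition dual_polytope :: "nat \<Rightarrow> (nat \<Rightarrow> real) set \<Rightarrow> (nat \<Rightarrow> real) set" where
  "dual_polytope d P = {x \<in> topspace (Euclidean_space d). \<forall>y\<in>P. dot d y x \<le> 1}"

definition reflexive_polytope :: "nat \<Rightarrow> (nat \<Rightarrow> real) set \<Rightarrow> bool" where
  "reflexive_polytope d P \<longleftrightarrow>
     lattice_polytope d P \<and> 0 \<in> Euclidean_space d interior_of P \<and>
     lattice_polytope d (dual_polytope d P)"

text \<open>
  \<open>Lambda_group d v\<close> is \<open>\<Lambda>\<close> of the simplex in \<open>\<real>\<^sup>d\<close> with ordered vertices \<open>v 0, \<dots>, v d\<close>.
  For \<open>v i \<in> \<real>\<^sup>d\<close>, the update \<open>(v i)(d := 1)\<close> is the point \<open>(v i, 1)\<close> of \<open>\<real>\<^sup>d\<^sup>+\<^sup>1\<close>.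
\<close>

definition Lambda_group :: "nat \<Rightarrow> (nat \<Rightarrow> nat \<Rightarrow> real) \<Rightarrow> (nat \<Rightarrow> real) set" where
  "Lambda_group d v =
     {l \<in> topspace (Euclidean_space (d + 1)).
        (\<forall>i<d + 1. 0 \<le> l i \<and> l i < 1) \<and>
        (\<Sum>i<d + 1. l i *\<^sub>R (v i)(d := 1)) \<in> integer_lattice (d + 1)}"


subsection \<open>Codes over the integers modulo n\<close>

text \<open>
  The elements of \<open>\<int>\<^sub>n\<close> are represented by \<open>0, \<dots>, n - 1\<close>, and the vectors in \<open>\<int>\<^sub>n\<^sup>n\<close> are
  again extended by 0 outside \<open>{0..<n}\<close>.
\<close>

definition Zmod_vectors :: "nat \<Rightarrow> (nat \<Rightarrow> int) set" where
  "Zmod_vectors n = {x. (\<forall>i<n. 0 \<le> x i \<and> x i < int n) \<and> (\<forall>i\<ge>n. x i = 0)}"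

definition dual_code :: "nat \<Rightarrow> (nat \<Rightarrow> int) set \<Rightarrow> (nat \<Rightarrow> int) set" where
  "dual_code n C = {y \<in> Zmod_vectors n. \<forall>c\<in>C. [(\<Sum>i<n. y i * c i) = 0] (mod int n)}"


subsection \<open>The Laplacian simplex of a graph and its code\<close>

text \<open>
  A simple graph is a \<^locale>\<open>pair_graph\<close>: a finite loop-free symmetric digraph without parallel
  arcs. The edge \<open>{i, j}\<close> is represented by the two arcs \<open>(i, j)\<close> and \<open>(j, i)\<close>, so the
  out-degree of a vertex is its degree.
\<close>

definition laplacian :: "nat pair_pre_digraph \<Rightarrow> nat \<Rightarrow> nat \<Rightarrow> int" where
  "laplacian G i j =
     (if i = j then int (out_degree (with_proj G) i)
      else if (i, j) \<in> parcs G then - 1 else 0)"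

definition laplacian_row :: "nat \<Rightarrow> nat pair_pre_digraph \<Rightarrow> nat \<Rightarrow> nat \<Rightarrow> real" where
  "laplacian_row n G i = (\<lambda>k. if k < n - 1 then real_of_int (laplacian G i k) else 0)"

definition laplacian_simplex :: "nat \<Rightarrow> nat pair_pre_digraph \<Rightarrow> (nat \<Rightarrow> real) set" where
  "laplacian_simplex n G = convex hull (laplacian_row n G ` {0..<n})"

definition dual_laplacian_simplex :: "nat \<Rightarrow> nat pair_pre_digraph \<Rightarrow> (nat \<Rightarrow> real) set" where
  "dual_laplacian_simplex n G =
     {x \<in> topspace (Euclidean_space (n - 1)). \<forall>i<n. dot (n - 1) (laplacian_row n G i) x \<le> 1}"

lemma dual_polytope_laplacian_simplex:
  "dual_polytope (n - 1) (laplacian_simplex n G) = dual_laplacian_simplex n G"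
proof -
  have "(\<forall>y\<in>laplacian_simplex n G. dot (n - 1) y x \<le> 1) \<longleftrightarrow>
        (\<forall>i<n. dot (n - 1) (laplacian_row n G i) x \<le> 1)" for x
  proof
    assume "\<forall>y\<in>laplacian_simplex n G. dot (n - 1) y x \<le> 1"
    then show "\<forall>i<n. dot (n - 1) (laplacian_row n G i) x \<le> 1"
      by (auto simp: laplacian_simplex_def intro!: hull_inc)
  next
    assume rows: "\<forall>i<n. dot (n - 1) (laplacian_row n G i) x \<le> 1"
    have lin: "dot d (u *\<^sub>R y + v *\<^sub>R z) x = u * dot d y x + v * dot d z x"
      for d u v y z
      by (simp add: dot_def scaleR_fun_def sum_distrib_left sum.distrib algebra_simps)
    have "convex {y. dot (n - 1) y x \<le> 1}"
      unfolding convex_def by (auto simp: lin intro!: convex_bound_le)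
    then have "laplacian_simplex n G \<subseteq> {y. dot (n - 1) y x \<le> 1}"
      unfolding laplacian_simplex_def using rows by (intro hull_minimal) auto
    then show "\<forall>y\<in>laplacian_simplex n G. dot (n - 1) y x \<le> 1" by auto
  qed
  then show ?thesis by (simp add: dual_polytope_def dual_laplacian_simplex_def)
qed

text \<open>The matrix \<open>[L(n) | 1]\<close>: the last column of the Laplacian is replaced by ones.\<close>

definition code_matrix :: "nat \<Rightarrow> nat pair_pre_digraph \<Rightarrow> nat \<Rightarrow> nat \<Rightarrow> int" where
  "code_matrix n G i k = (if k < n - 1 then laplacian G i k else 1)"

definition laplacian_code :: "nat \<Rightarrow> nat pair_pre_digraph \<Rightarrow> (nat \<Rightarrow> int) set" where
  "laplacian_code n G =
     {x \<in> Zmod_vectors n. \<forall>k<n. [(\<Sum>i<n. x i * code_matrix n G i k) = 0] (mod int n)}"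

end

theory Submission
  imports Defs "Jordan_Normal_Form.Determinant"
begin

text \<open>
  Let \<open>M = [L(n) | 1]\<close> and let \<open>W\<close> be the matrix with rows \<open>(- v\<^sub>i, 1)\<close>. The rows of \<open>L(n)\<close> add up
  to zero, so the diagonal products are \<open>\<ell>\<^sub>i \<cdot> v\<^sub>i = 1 - n\<close>, and hence \<open>M W\<^sup>T = n I = W\<^sup>T M\<close>.
  Reflexivity makes \<open>W\<close> integral. The second equation says that the columns of \<open>W\<close> are codewords
  modulo \<open>n\<close>, and by the first one they generate the code: if \<open>c M = n u\<close>, then \<open>c = u W\<^sup>T\<close>.
  Therefore \<open>x\<close> lies in the dual code iff \<open>(x / n) W\<close> is integral. Finally, every \<open>\<lambda>\<close> with \<open>\<lambda> W\<close>
  integral has the form \<open>x / n\<close>, because \<open>n \<lambda> = \<lambda> W M\<^sup>T\<close>.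
\<close>

text \<open>Over a field, a one-sided inverse of a square matrix is two-sided; this is applied to
  \<open>A\<close> and \<open>B / c\<close>. It turns the relation between rows and dual vertices
  into one about the columns of \<open>[L(n) | 1]\<close>.\<close>

lemma scalar_matrix_product_commute:
  fixes A B :: "nat \<Rightarrow> nat \<Rightarrow> 'a::field"
  assumes AB: "\<And>i j. i < n \<Longrightarrow> j < n \<Longrightarrow> (\<Sum>k<n. A i k * B k j) = (if i = j then c else 0)"
    and "c \<noteq> 0" "i < n" "j < n"
  shows "(\<Sum>k<n. B i k * A k j) = (if i = j then c else 0)"
proof -
  define P where "P = mat n n (\<lambda>(i, j). A i j)"
  define Q where "Q = mat n n (\<lambda>(i, j). B i j / c)"
  have P: "P \<in> carrier_mat n n" and Q: "Q \<in> carrier_mat n n"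
    by (simp_all add: P_def Q_def)
  have "P * Q = 1\<^sub>m n"
    by (rule eq_matI)
      (use \<open>c \<noteq> 0\<close> in \<open>auto simp: P_def Q_def scalar_prod_def atLeast0LessThan AB
        simp flip: sum_divide_distrib\<close>)
  then have "Q * P = 1\<^sub>m n"
    using P Q mat_mult_left_right_inverse by blast
  then have "(Q * P) $$ (i, j) = 1\<^sub>m n $$ (i, j)"
    by simp
  then have "(\<Sum>k<n. B i k * A k j) / c = (if i = j then 1 else 0)"
    using \<open>i < n\<close> \<open>j < n\<close>
    by (simp add: P_def Q_def scalar_prod_def atLeast0LessThan sum_divide_distrib)
  then show ?thesis
    using \<open>c \<noteq> 0\<close> by (auto simp: divide_simps split: if_splits)
qed

text \<open>Every extreme point of \<open>convex hull S\<close> belongs to \<open>S\<close>. This is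
  how reflexivity makes the dual vertices integral.\<close>

lemma extreme_point_of_lattice_polytope:
  assumes "lattice_polytope d P" "x extreme_point_of P"
  shows "x \<in> integer_lattice d"
  using assms extreme_point_of_convex_hull unfolding lattice_polytope_def by blast

lemma sum_apply: "(\<Sum>i\<in>I. f i) x = (\<Sum>i\<in>I. f i x)"
  by (induction I rule: infinite_finite_induct) auto

text \<open>The degree on the diagonal cancels one \<open>- 1\<close> per neighbour. Symmetry of the
  arcs lets column \<open>k\<close> be counted by the out-neighbours \<open>N\<close> of
  \<open>k\<close>.\<close>

lemma laplacian_column_sum:
  assumes "pair_graph G" "pverts G = {0..<n}" "k < n"
  shows "(\<Sum>j<n. laplacian G j k) = 0"
proof -
  interpret pair_graph G by fact
  have sym: "(a, b) \<in> parcs G \<longleftrightarrow> (b, a) \<in> parcs G" for a b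
    using pair_sym_arcs arcs_symmetric by auto
  have loopfree: "(k, k) \<notin> parcs G"
    using pair_no_loops by fastforce
  define N where "N = {j \<in> {..<n}. (k, j) \<in> parcs G}"
  have "out_arcs (with_proj G) k = Pair k ` N"
    using in_arcsD2 assms(2) by (auto simp: out_arcs_def N_def)
  then have deg: "out_degree (with_proj G) k = card N"
    by (simp add: out_degree_def card_image inj_on_def)
  \<comment> \<open>Split each entry into its degree part and its adjacency part; the two do not
    clash at \<open>j = k\<close> because there are no loops.\<close>
  have "(\<Sum>j<n. laplacian G j k) =
      (\<Sum>j<n. (if j = k then int (card N) else 0) + (if (k, j) \<in> parcs G then - 1 else 0))"
  proof (rule sum.cong[OF refl])
    fix j
    show "laplacian G j k =
        (if j = k then int (card N) else 0) + (if (k, j) \<in> parcs G then - 1 else 0)"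
      using sym[of j k] by (cases "j = k") (simp_all add: laplacian_def deg loopfree)
  qed
  also have "\<dots> = int (card N) - int (card N)"
    using assms(3) by (simp add: sum.distrib N_def flip: sum.inter_filter)
  finally show ?thesis by simp
qed

text \<open>By the column sums the \<open>n\<close> products add up to 0, and \<open>n - 1\<close>
  of them equal 1.\<close>

lemma dual_vertex_opposite_row:
  assumes G: "pair_graph G" "pverts G = {0..<n}" and "i < n"
    and other: "\<And>j. j < n \<Longrightarrow> j \<noteq> i \<Longrightarrow> dot (n - 1) (laplacian_row n G j) x = 1"
  shows "dot (n - 1) (laplacian_row n G i) x = 1 - real n"
proof -
  have "(\<Sum>j<n. dot (n - 1) (laplacian_row n G j) x) =
      (\<Sum>k<n - 1. real_of_int (\<Sum>j<n. laplacian G j k) * x k)"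
    unfolding dot_def laplacian_row_def
    by (subst sum.swap) (auto simp: sum_distrib_right intro!: sum.cong)
  also have "\<dots> = 0"
    by (rule sum.neutral) (use laplacian_column_sum[OF G] in auto)
  finally have "(\<Sum>j<n. dot (n - 1) (laplacian_row n G j) x) = 0" .
  moreover have "(\<Sum>j<n. dot (n - 1) (laplacian_row n G j) x) =
      dot (n - 1) (laplacian_row n G i) x + (\<Sum>j\<in>{..<n} - {i}. 1)"
    using \<open>i < n\<close> other by (subst sum.remove[of _ i]) auto
  ultimately show ?thesis
    using \<open>i < n\<close> by (simp add: of_nat_diff)
qed

text \<open>The columns of \<open>Z\<close>, reduced modulo \<open>n\<close>, generate the code
  \<open>C\<close>: \<open>ZA\<close> makes them codewords, and \<open>AZ\<close> shows that
  orthogonality to them suffices.\<close>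

lemma dual_code_iff_generators:
  fixes A Z :: "nat \<Rightarrow> nat \<Rightarrow> int"
  assumes "n > 0"
    and AZ: "\<And>j i. j < n \<Longrightarrow> i < n \<Longrightarrow> (\<Sum>k<n. A j k * Z i k) = (if j = i then int n else 0)"
    and ZA: "\<And>k l. k < n \<Longrightarrow> l < n \<Longrightarrow> (\<Sum>i<n. Z i k * A i l) = (if k = l then int n else 0)"
    and C: "C = {x \<in> Zmod_vectors n. \<forall>k<n. [(\<Sum>i<n. x i * A i k) = 0] (mod int n)}"
    and y: "y \<in> Zmod_vectors n"
  shows "y \<in> dual_code n C \<longleftrightarrow> (\<forall>k<n. int n dvd (\<Sum>i<n. y i * Z i k))"
proof
  assume dual: "y \<in> dual_code n C"
  show "\<forall>k<n. int n dvd (\<Sum>i<n. y i * Z i k)"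
  proof (intro allI impI)
    fix k assume "k < n"
    \<comment> \<open>Column \<open>k\<close> of \<open>Z\<close>, replaced by its representatives
      in \<open>0, ..., n - 1\<close> as \<open>Zmod_vectors\<close> demands.\<close>
    define c where "c i = (if i < n then Z i k mod int n else 0)" for i
    have "[(\<Sum>i<n. c i * A i l) = (\<Sum>i<n. Z i k * A i l)] (mod int n)" for l
      by (intro cong_sum cong_mult cong_refl) (auto simp: c_def cong_def)
    moreover have "[(\<Sum>i<n. Z i k * A i l) = 0] (mod int n)" if "l < n" for l
      using ZA[OF \<open>k < n\<close> that] by (auto simp: cong_def)
    ultimately have "c \<in> C"
      using \<open>n > 0\<close> unfolding C Zmod_vectors_def by (auto simp: c_def intro: cong_trans)
    then have "[(\<Sum>i<n. y i * c i) = 0] (mod int n)"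
      using dual by (auto simp: dual_code_def)
    moreover have "[(\<Sum>i<n. y i * Z i k) = (\<Sum>i<n. y i * c i)] (mod int n)"
      by (intro cong_sum cong_mult cong_refl) (auto simp: c_def cong_def)
    ultimately show "int n dvd (\<Sum>i<n. y i * Z i k)"
      by (meson cong_0_iff cong_trans)
  qed
next
  assume dvd: "\<forall>k<n. int n dvd (\<Sum>i<n. y i * Z i k)"
  have "int n dvd (\<Sum>i<n. y i * c i)" if "c \<in> C" for c
  proof -
    have "\<forall>k<n. int n dvd (\<Sum>j<n. c j * A j k)"
      using that by (simp add: C cong_0_iff)
    \<comment> \<open>Both factors are multiples of \<open>n\<close>. Summed over \<open>k\<close>,
      the products collapse by \<open>AZ\<close> to \<open>n\<close> times the pairing of
      \<open>y\<close> and \<open>c\<close>, so one factor \<open>n\<close> can be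
      cancelled.\<close>
    then have "\<forall>k<n. int n * int n dvd (\<Sum>j<n. c j * A j k) * (\<Sum>i<n. y i * Z i k)"
      using dvd by (simp add: mult_dvd_mono)
    then have "int n * int n dvd (\<Sum>k<n. (\<Sum>j<n. c j * A j k) * (\<Sum>i<n. y i * Z i k))"
      by (intro dvd_sum) auto
    also have "(\<Sum>k<n. (\<Sum>j<n. c j * A j k) * (\<Sum>i<n. y i * Z i k)) =
        (\<Sum>k<n. \<Sum>j<n. \<Sum>i<n. c j * y i * (A j k * Z i k))"
      by (simp add: sum_product mult_ac)
    also have "\<dots> = (\<Sum>j<n. \<Sum>i<n. \<Sum>k<n. c j * y i * (A j k * Z i k))"
      by (subst sum.swap, rule sum.cong[OF refl], rule sum.swap)
    also have "\<dots> = (\<Sum>j<n. \<Sum>i<n. c j * y i * (if j = i then int n else 0))"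
      by (simp add: AZ flip: sum_distrib_left)
    also have "\<dots> = int n * (\<Sum>i<n. y i * c i)"
      by (simp add: sum_distrib_left if_distrib mult_ac cong: if_cong)
    finally show ?thesis
      using \<open>n > 0\<close> by simp
  qed
  then show "y \<in> dual_code n C"
    using y by (simp add: dual_code_def cong_0_iff)
qed

text \<open>Multiplying the integral vector \<open>l Z\<close> by row \<open>j\<close> of the
  integer matrix \<open>A\<close> gives \<open>m * l j\<close>. With \<open>m = n\<close> this
  bounds the denominators in \<open>Lambda_group\<close>.\<close>

lemma integral_combination_imp_multiple_integral:
  fixes A Z :: "nat \<Rightarrow> nat \<Rightarrow> int" and l :: "nat \<Rightarrow> real"
  assumes AZ: "\<And>i. i < n \<Longrightarrow> (\<Sum>k<n. A j k * Z i k) = (if j = i then m else 0)"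
    and int: "\<And>k. k < n \<Longrightarrow> (\<Sum>i<n. l i * Z i k) \<in> \<int>"
    and "j < n"
  shows "m * l j \<in> \<int>"
proof -
  have "(\<Sum>k<n. A j k * (\<Sum>i<n. l i * Z i k)) = (\<Sum>i<n. l i * of_int (\<Sum>k<n. A j k * Z i k))"
    unfolding of_int_sum of_int_mult sum_distrib_left
    by (subst sum.swap) (simp add: mult_ac)
  also have "\<dots> = m * l j"
    using \<open>j < n\<close> by (simp add: AZ if_distrib mult_ac cong: if_cong)
  finally show ?thesis
    using int by (metis (no_types, lifting) Ints_mult Ints_of_int Ints_sum lessThan_iff)
qed

text \<open>The rows of \<open>Z\<close> are the points \<open>(v i, 1)\<close> with all but the
  last coordinate negated, and a sign does not affect integrality.\<close>

lemma Lambda_group_iff: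
  fixes Z :: "nat \<Rightarrow> nat \<Rightarrow> int"
  assumes "n > 0"
    and v: "\<And>i. i < n \<Longrightarrow> v i \<in> topspace (Euclidean_space (n - 1))"
    and Z: "\<And>i k. i < n \<Longrightarrow> k < n \<Longrightarrow> real_of_int (Z i k) = (if k < n - 1 then - v i k else 1)"
  shows "l \<in> Lambda_group (n - 1) v \<longleftrightarrow>
    (\<forall>i<n. 0 \<le> l i \<and> l i < 1) \<and> (\<forall>i\<ge>n. l i = 0) \<and> (\<forall>k<n. (\<Sum>i<n. l i * Z i k) \<in> \<int>)"
proof -
  define s where "s = (\<Sum>i<n. l i *\<^sub>R (v i)(n - 1 := 1))"
  have s: "s k = (\<Sum>i<n. l i * ((v i)(n - 1 := 1)) k)" for k
    by (simp add: s_def sum_apply scaleR_fun_def)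
  \<comment> \<open>Each \<open>v i\<close> vanishes from index \<open>n - 1\<close> on, and the
    appended 1 sits exactly at \<open>n - 1\<close>.\<close>
  have outside: "s k = 0" if "k \<ge> n" for k
    unfolding s
  proof (rule sum.neutral, rule ballI)
    fix i assume "i \<in> {..<n}"
    then show "l i * ((v i)(n - 1 := 1)) k = 0"
      using v[of i] that \<open>n > 0\<close> by (auto simp: topspace_Euclidean_space)
  qed
  have "s k = (if k < n - 1 then - (\<Sum>i<n. l i * Z i k) else (\<Sum>i<n. l i * Z i k))" if "k < n" for k
    using that by (auto simp: s Z sum_negf intro!: sum.cong)
  then have "s k \<in> \<int> \<longleftrightarrow> (\<Sum>i<n. l i * Z i k) \<in> \<int>" if "k < n" for k
    using that by (simp add: minus_in_Ints_iff)
  then have "s \<in> integer_lattice n \<longleftrightarrow> (\<forall>k<n. (\<Sum>i<n. l i * Z i k) \<in> \<int>)"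
    unfolding integer_lattice_def topspace_Euclidean_space
    using outside by (auto, metis Ints_0 not_le)
  then show ?thesis
    using \<open>n > 0\<close> by (auto simp: Lambda_group_def s_def topspace_Euclidean_space)
qed

theorem theorem3p14:
  fixes n :: nat and G :: "nat pair_pre_digraph" and v :: "nat \<Rightarrow> nat \<Rightarrow> real"
  assumes "n \<ge> 1"
    and "pair_graph G"
    and "pverts G = {0..<n}"
    and "Digraph_Component.connected (with_proj G)"
    and "reflexive_polytope (n - 1) (laplacian_simplex n G)"
    and "bij_betw v {0..<n} {x. x extreme_point_of dual_laplacian_simplex n G}"
    and "\<And>i j. i < n \<Longrightarrow> j < n \<Longrightarrow> j \<noteq> i \<Longrightarrow> dot (n - 1) (laplacian_row n G j) (v i) = 1"
  shows "Lambda_group (n - 1) v =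
    {(\<lambda>i. real_of_int (x i) / real n) | x :: nat \<Rightarrow> int.
       (\<forall>i<n. 0 \<le> x i \<and> x i < int n) \<and> (\<forall>i\<ge>n. x i = 0) \<and>
       (\<lambda>i. x i mod int n) \<in> dual_code n (laplacian_code n G)}"
proof -
  have "n > 0" using \<open>n \<ge> 1\<close> by simp
  have v: "v i \<in> integer_lattice (n - 1)" if "i < n" for i
  proof (rule extreme_point_of_lattice_polytope)
    show "lattice_polytope (n - 1) (dual_laplacian_simplex n G)"
      using assms(5) unfolding reflexive_polytope_def dual_polytope_laplacian_simplex by blast
    show "v i extreme_point_of dual_laplacian_simplex n G"
      using bij_betwE[OF assms(6)] that by auto
  qed
  define A where "A = code_matrix n G"
  \<comment> \<open>The matrix \<open>W\<close> as an integer matrix; the floor is exact because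
    each \<open>v i\<close> is a lattice point.\<close>
  define Z where "Z i k = (if k < n - 1 then - \<lfloor>v i k\<rfloor> else 1)" for i k
  have Z: "real_of_int (Z i k) = (if k < n - 1 then - v i k else 1)" if "i < n" for i k
    using v[OF that] by (simp add: Z_def integer_lattice_def)
  have AZ_real: "(\<Sum>k<n. real_of_int (A j k) * real_of_int (Z i k)) = (if j = i then real n else 0)"
    if "j < n" "i < n" for i j
  proof -
    \<comment> \<open>The last column contributes \<open>1 * 1\<close>, so the entry is 1 minus the
      product of row \<open>j\<close> with \<open>v i\<close>: this is 0 off the diagonal and
      \<open>1 - (1 - n) = n\<close> on it.\<close>
    have "{..<n} = insert (n - 1) {..<n - 1}"
      using \<open>n > 0\<close> by auto
    then have "(\<Sum>k<n. real_of_int (A j k) * real_of_int (Z i k)) =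
        1 - dot (n - 1) (laplacian_row n G j) (v i)"
      using \<open>i < n\<close> by (simp add: A_def Z code_matrix_def dot_def laplacian_row_def sum_negf)
    then show ?thesis
      using assms(7) dual_vertex_opposite_row[OF assms(2,3) \<open>i < n\<close>, of "v i"] that by auto
  qed
  have AZ: "(\<Sum>k<n. A j k * Z i k) = (if j = i then int n else 0)" if "j < n" "i < n" for i j
  proof -
    have "real_of_int (\<Sum>k<n. A j k * Z i k) = real_of_int (if j = i then int n else 0)"
      using AZ_real[OF that] by simp
    then show ?thesis by (simp only: of_int_eq_iff)
  qed
  have ZA: "(\<Sum>i<n. Z i k * A i m) = (if k = m then int n else 0)" if "k < n" "m < n" for k m
  proof -
    have "real_of_int (\<Sum>i<n. Z i k * A i m) = real_of_int (if k = m then int n else 0)"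
      \<comment> \<open>The second factor is the transpose of \<open>Z\<close>.\<close>
      using scalar_matrix_product_commute
          [of n "\<lambda>i k. real_of_int (A i k)" "\<lambda>k i. real_of_int (Z i k)" "real n" k m]
        AZ_real that \<open>n > 0\<close> by simp
    then show ?thesis by (simp only: of_int_eq_iff)
  qed
  have dual: "x \<in> dual_code n (laplacian_code n G) \<longleftrightarrow> (\<forall>k<n. int n dvd (\<Sum>i<n. x i * Z i k))"
    if "x \<in> Zmod_vectors n" for x
    using dual_code_iff_generators[OF \<open>n > 0\<close> AZ ZA _ that] by (simp add: laplacian_code_def A_def)
  have Lambda: "l \<in> Lambda_group (n - 1) v \<longleftrightarrow>
    (\<forall>i<n. 0 \<le> l i \<and> l i < 1) \<and> (\<forall>i\<ge>n. l i = 0) \<and> (\<forall>k<n. (\<Sum>i<n. l i * Z i k) \<in> \<int>)" for l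
    by (rule Lambda_group_iff[OF \<open>n > 0\<close>]) (use v Z in \<open>auto simp: integer_lattice_def\<close>)
  have integral: "(\<Sum>i<n. real_of_int (x i) / real n * Z i k) \<in> \<int> \<longleftrightarrow>
      int n dvd (\<Sum>i<n. x i * Z i k)" for x k
  proof -
    have "(\<Sum>i<n. real_of_int (x i) / real n * Z i k) =
        real_of_int (\<Sum>i<n. x i * Z i k) / real_of_int (int n)"
      by (simp add: sum_divide_distrib)
    then show ?thesis
      using \<open>n > 0\<close> by (simp only: of_int_div_of_int_in_Ints_iff) simp
  qed
  have Lambda_of_int: "(\<lambda>i. real_of_int (x i) / real n) \<in> Lambda_group (n - 1) v \<longleftrightarrow>
      (\<forall>i<n. 0 \<le> x i \<and> x i < int n) \<and> (\<forall>i\<ge>n. x i = 0) \<and>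
      (\<lambda>i. x i mod int n) \<in> dual_code n (laplacian_code n G)" for x :: "nat \<Rightarrow> int"
  proof -
    have "(\<lambda>i. real_of_int (x i) / real n) \<in> Lambda_group (n - 1) v \<longleftrightarrow>
        x \<in> Zmod_vectors n \<and> (\<forall>k<n. int n dvd (\<Sum>i<n. x i * Z i k))"
      unfolding Lambda integral Zmod_vectors_def
      using \<open>n > 0\<close> by (auto simp: zero_le_divide_iff)
    also have "\<dots> \<longleftrightarrow> x \<in> Zmod_vectors n \<and> x \<in> dual_code n (laplacian_code n G)"
      using dual by blast
    also have "\<dots> \<longleftrightarrow>
        x \<in> Zmod_vectors n \<and> (\<lambda>i. x i mod int n) \<in> dual_code n (laplacian_code n G)"
    proof -
      \<comment> \<open>Entries below index \<open>n\<close> are already reduced, and those beyond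
        are 0.\<close>
      have "(\<lambda>i. x i mod int n) = x" if "x \<in> Zmod_vectors n"
        using that by (auto simp: Zmod_vectors_def fun_eq_iff) (metis mod_0 mod_pos_pos_trivial not_le)
      then show ?thesis by metis
    qed
    finally show ?thesis by (simp add: Zmod_vectors_def)
  qed
  have "\<exists>x. l = (\<lambda>i. real_of_int (x i) / real n)" if "l \<in> Lambda_group (n - 1) v" for l
  proof -
    have "real n * l i \<in> \<int>" for i
    proof (cases "i < n")
      case True
      then show ?thesis
        using integral_combination_imp_multiple_integral[of n A i Z "int n" l] AZ that Lambda by simp
    next
      case False
      then show ?thesis using that Lambda by simp
    qed
    \<comment> \<open>The numerators are \<open>n * l i\<close>, on which the floor is exact; from
      index \<open>n\<close> on they are 0.\<close>
    then have "l = (\<lambda>i. real_of_int \<lfloor>real n * l i\<rfloor> / real n)"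
      using \<open>n > 0\<close> by simp
    then show ?thesis by (rule exI[where x = "\<lambda>i. \<lfloor>real n * l i\<rfloor>"])
  qed
  then show ?thesis
    using Lambda_of_int by blast
qed

end
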